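(* Let $n\ge 1$ and $1\le k\le 2n$ be integers, and let $G=\mathcal{G}_{n,k}$ be the Two-Radius graph with $n$ source nodes, $n$ target nodes and $k$ central nodes. Then the Cheeger constant of $G$ satisfies $$h_G\ \ge\ \frac{k}{8}.$$
   Context: **The graph $\mathcal{G}_{n,k}$.** Its node set is $V=S\sqcup C\sqcup T$ with $|S|=n$ (source nodes), $|C|=k$ (central nodes) and $|T|=n$ (target nodes). Each central node is adjacent to all source nodes and all target nodes, and there are no other edges. (Node features play no role here; thus the graph is the complete bipartite graph between $C$ and $S\cup T$.) **Cheeger constant.** For a finite graph $G=(V,E)$ and $A\subseteq V$, let $|\partial A|$ be the number of edges with one endpoint in $A$ and the other in $V\setminus A$. The Cheeger constant is $$h_G=\min_{A\subseteq V,\ 0<|A|\le |V|/2}\ \frac{|\partial A|}{|A|}.$$ *)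

theory Defs
  imports Complex_Main "Graph_Theory.Pair_Digraph"
begin

text \<open>
  As in the Graph_Theory entry, an undirected graph is a symmetric digraph. The edge boundary
  consists of the unordered pairs \<open>{u, v}\<close>, so each undirected edge is counted once.
\<close>

definition edge_boundary :: "'a pair_pre_digraph \<Rightarrow> 'a set \<Rightarrow> 'a set set" where
  "edge_boundary G A = {{u, v} | u v. (u, v) \<in> parcs G \<and> u \<in> A \<and> v \<in> pverts G - A}"

text \<open>
  The minimum is meaningful only for finite graphs with at least two vertices;
  see \<open>cheeger_ratios_finite\<close> and \<open>cheeger_ratios_nonempty\<close>.
\<close>

definition cheeger_ratios :: "'a pair_pre_digraph \<Rightarrow> real set" where
  "cheeger_ratios G = {real (card (edge_boundary G A)) / real (card A) | A.
     A \<subseteq> pverts G \<and> 0 < card A \<and> real (card A) \<le> real (card (pverts G)) / 2}"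

definition cheeger_constant :: "'a pair_pre_digraph \<Rightarrow> real" where
  "cheeger_constant G = Min (cheeger_ratios G)"

lemma cheeger_ratios_finite:
  assumes "finite (pverts G)"
  shows "finite (cheeger_ratios G)"
proof -
  have "cheeger_ratios G \<subseteq>
      (\<lambda>A. real (card (edge_boundary G A)) / real (card A)) ` Pow (pverts G)"
    unfolding cheeger_ratios_def by auto
  then show ?thesis
    using assms by (meson finite_Pow_iff finite_imageI finite_subset)
qed

lemma cheeger_ratios_nonempty:
  assumes "2 \<le> card (pverts G)"
  shows "cheeger_ratios G \<noteq> {}"
proof -
  obtain x where "x \<in> pverts G"
    using assms by fastforce
  then have "real (card (edge_boundary G {x})) / real (card {x}) \<in> cheeger_ratios G"
    unfolding cheeger_ratios_def using assms by (intro CollectI exI[of _ "{x}"]) auto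
  then show ?thesis by blast
qed

definition two_radius_graph :: "'a set \<Rightarrow> 'a set \<Rightarrow> 'a set \<Rightarrow> 'a pair_pre_digraph" where
  "two_radius_graph S C T =
     \<lparr> pverts = S \<union> C \<union> T, parcs = C \<times> (S \<union> T) \<union> (S \<union> T) \<times> C \<rparr>"

lemma pair_graph_two_radius_graph:
  assumes "finite S" "finite C" "finite T" "S \<inter> C = {}" "C \<inter> T = {}"
  shows "pair_graph (two_radius_graph S C T)"
  using assms
  by unfold_locales (auto simp: two_radius_graph_def symmetric_def arcs_ends_def sym_def
      arc_to_ends_def)

end

theory Submission
  imports Defs
begin

text \<open>
  Put \<open>m = 2 * n\<close>. A set with \<open>c\<close> central and \<open>p\<close> non-central nodes has
  \<open>c * (m - p) + (k - c) * p\<close> boundary edges. If \<open>c \<le> k / 2\<close> and \<open>p \<le> m / 2\<close>, this is at least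
  \<open>(c * m + k * p) / 2\<close>. Otherwise exactly one of the two bounds fails, because
  \<open>c + p \<le> (k + m) / 2\<close>, and a single summand is at least \<open>k * m / 4\<close>.
  As \<open>k \<le> m\<close>, either way the boundary has at least \<open>k * (c + p) / 4\<close> edges.
\<close>

text \<open>Every edge has exactly one central endpoint, so listing that endpoint first encodes
  boundary edges as ordered pairs, split by whether the central endpoint lies in
  \<open>A\<close>.\<close>

lemma card_edge_boundary_two_radius_graph:
  assumes "finite S" "finite C" "finite T" "(S \<union> T) \<inter> C = {}"
  shows "card (edge_boundary (two_radius_graph S C T) A) =
    card (C \<inter> A) * card (S \<union> T - A) + card (C - A) * card ((S \<union> T) \<inter> A)"
proof -
  let ?B = "S \<union> T"
  let ?X = "(C \<inter> A) \<times> (?B - A)" and ?Y = "(C - A) \<times> (?B \<inter> A)"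
  have eq: "edge_boundary (two_radius_graph S C T) A = (\<lambda>(u, v). {u, v}) ` (?X \<union> ?Y)"
  proof (rule set_eqI, rule iffI)
    fix e assume "e \<in> edge_boundary (two_radius_graph S C T) A"
    then obtain u v where e: "e = {u, v}" and "u \<in> A" "v \<notin> A"
      and "(u, v) \<in> C \<times> ?B \<or> (v, u) \<in> C \<times> ?B"
      by (auto simp: edge_boundary_def two_radius_graph_def)
    then have "(u, v) \<in> ?X \<or> (v, u) \<in> ?Y" by auto
    moreover have "e = {v, u}" using e by auto
    ultimately show "e \<in> (\<lambda>(u, v). {u, v}) ` (?X \<union> ?Y)"
      using e by (auto intro: rev_image_eqI)
  next
    fix e assume "e \<in> (\<lambda>(u, v). {u, v}) ` (?X \<union> ?Y)"
    then obtain u v where e: "e = {u, v}" "e = {v, u}" and "(u, v) \<in> ?X \<or> (u, v) \<in> ?Y"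
      by auto
    then show "e \<in> edge_boundary (two_radius_graph S C T) A"
      unfolding edge_boundary_def two_radius_graph_def by fastforce
  qed
  \<comment> \<open>A swapped pair would put a node in both \<open>C\<close> and
    \<open>S \<union> T\<close>.\<close>
  have "inj_on (\<lambda>(u, v). {u, v}) (?X \<union> ?Y)"
    using assms(4) by (auto simp: inj_on_def doubleton_eq_iff)
  moreover have "card (?X \<union> ?Y) = card ?X + card ?Y"
    using assms by (intro card_Un_disjoint) auto
  ultimately show ?thesis
    by (simp add: eq card_image card_cartesian_product)
qed

text \<open>Stated over the reals so that \<open>m - p\<close> and \<open>k - c\<close> are not
  truncated.\<close>

lemma bipartite_cut_ge:
  fixes c p k m :: real
  assumes "0 \<le> c" "c \<le> k" "0 \<le> p" "p \<le> m" "k \<le> m" "2 * (c + p) \<le> k + m"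
  shows "k * (c + p) \<le> 4 * (c * (m - p) + (k - c) * p)"
proof -
  have nonneg: "0 \<le> c * (m - p)" "0 \<le> (k - c) * p"
    using assms by simp_all
  \<comment> \<open>Here \<open>c + p \<le> (k + m) / 2 \<le> m\<close>.\<close>
  have km: "k * (c + p) \<le> k * m"
    using assms by (intro mult_left_mono) auto
  consider "2 * c \<le> k" "2 * p \<le> m" | "2 * c \<le> k" "m \<le> 2 * p" | "k \<le> 2 * c" "2 * p \<le> m"
    using assms by (cases "2 * c \<le> k"; cases "2 * p \<le> m") auto
  then show ?thesis
  proof cases
    case 1
    \<comment> \<open>These use \<open>k \<le> m \<le> 2 * (m - p)\<close> and
      \<open>k \<le> 2 * (k - c)\<close>.\<close>
    have "c * k \<le> c * (2 * (m - p))" "k * p \<le> 2 * (k - c) * p"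
      using 1 assms by (intro mult_left_mono mult_right_mono; simp)+
    then show ?thesis using nonneg by (simp add: algebra_simps)
  next
    case 2
    have "k * m \<le> (2 * (k - c)) * (2 * p)"
      using 2 assms by (intro mult_mono) auto
    then show ?thesis using nonneg km by (simp add: algebra_simps)
  next
    case 3
    have "k * m \<le> (2 * c) * (2 * (m - p))"
      using 3 assms by (intro mult_mono) auto
    then show ?thesis using nonneg km by (simp add: algebra_simps)
  qed
qed

theorem theorem3:
  fixes S C T :: "'a set" and n k :: nat
  assumes "n \<ge> 1" and "1 \<le> k" and "k \<le> 2 * n"
    and "finite S" and "finite C" and "finite T"
    and "S \<inter> C = {}" and "S \<inter> T = {}" and "C \<inter> T = {}"
    and "card S = n" and "card C = k" and "card T = n"
  shows "cheeger_constant (two_radius_graph S C T) \<ge> real k / 8"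
proof -
  let ?G = "two_radius_graph S C T" and ?B = "S \<union> T"
  have verts: "pverts ?G = C \<union> ?B"
    by (auto simp: two_radius_graph_def)
  have disj: "?B \<inter> C = {}" and cardB: "card ?B = 2 * n"
    using assms by (auto simp: card_Un_disjoint)
  then have cardV: "card (pverts ?G) = k + 2 * n"
    using assms by (subst verts, subst card_Un_disjoint) auto
  have ratio: "real k / 8 \<le> real (card (edge_boundary ?G A)) / real (card A)"
    if A: "A \<subseteq> pverts ?G" "0 < card A" "real (card A) \<le> real (card (pverts ?G)) / 2" for A
  proof -
    define c p where "c = card (C \<inter> A)" and "p = card (?B \<inter> A)"
    have "A = (C \<inter> A) \<union> (?B \<inter> A)" using A(1) verts by auto
    then have cardA: "card A = c + p"
      unfolding c_def p_def using assms disj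
      by (metis Int_Un_distrib2 card_Un_disjoint finite_Int finite_Un inf_assoc inf_bot_left
          inf_commute inf_left_commute)
    have split: "card (C \<inter> A) + card (C - A) = k" "card (?B \<inter> A) + card (?B - A) = 2 * n"
      using assms cardB by (metis card_Int_Diff finite_Un)+
    then have diff: "real (card (C - A)) = real k - real c"
        "real (card (?B - A)) = 2 * real n - real p"
      and le: "c \<le> k" "p \<le> 2 * n"
      unfolding c_def p_def by linarith+
    have "real (card (edge_boundary ?G A)) = c * (2 * real n - p) + (real k - c) * p"
      using card_edge_boundary_two_radius_graph[of S C T A] assms disj diff
      by (simp add: c_def p_def)
    \<comment> \<open>With \<open>m = 2 * n\<close>, the size bound on \<open>A\<close> becomes the
      premise \<open>2 * (c + p) \<le> k + m\<close>.\<close>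
    moreover have "real k * (real c + p) \<le> 4 * (c * (2 * real n - p) + (real k - c) * p)"
      using A(3) le assms(3) by (intro bipartite_cut_ge) (auto simp: cardA cardV)
    \<comment> \<open>The factor 4 is relaxed to 8: the cut estimate gives the ratio bound
      \<open>k / 4\<close>, and only \<open>k / 8\<close> is claimed.\<close>
    ultimately have "real k * card A \<le> 8 * real (card (edge_boundary ?G A))"
      by (simp add: cardA)
    then show ?thesis using A(2) by (simp add: field_simps)
  qed
  \<comment> \<open>Bounding \<open>Min\<close> from below elementwise requires a finite nonempty
    set; nonemptiness follows from \<open>k + 2 * n \<ge> 2\<close>.\<close>
  have "finite (cheeger_ratios ?G)"
    using assms verts by (intro cheeger_ratios_finite) simp
  moreover have "cheeger_ratios ?G \<noteq> {}"
    using assms cardV by (intro cheeger_ratios_nonempty) simp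
  ultimately show ?thesis
    unfolding cheeger_constant_def
    by (rule Min.boundedI) (auto simp only: cheeger_ratios_def intro: ratio)
qed

end
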